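(* Let $X$ be a continuum with metric $d$ and let $\mathcal P$ be a class of polyhedra. The following statements are equivalent. (T1) $X$ is a $\mathcal P$-like continuum that does not have the fixed-point property. (T2) There is a sequence $(\mathcal U_n)_{n\ge 1}$ of finite open and taut $\mathcal P$-covers of $X$ such that (a) for each positive integer $n$, $\mathcal U_{n+1}$ strongly refines $\mathcal U_n$; (b) for each positive integer $n\ge 2$, $\mathcal U_n$ is a $\frac{\rho}{2^n}$-$\mathcal P$-cover, where $\rho=\min\{d(U,V) \mid U\cap V=\emptyset,\ U,V\in\mathcal U_1\}$; and (c) $(\mathcal U_n)$ follows a fixed-point-free pattern. (T3) There is a sequence $(\mathcal U_n)_{n\ge 1}$ of finite open and taut $\mathcal P$-covers of $X$ such that (a) for each positive integer $n$, $\mathcal U_{n+1}$ strongly refines $\mathcal U_n$; (b) $\lim_{n\to\infty}\operatorname{mesh}(\mathcal U_n)=0$; and (c) $(\mathcal U_n)$ follows a type-(D2') fixed-point-free pattern.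
   Context: A continuum is a nonempty compact connected metric space. A space $X$ has the fixed-point property if every continuous $f:X\to X$ has a point $p$ with $f(p)=p$. For subsets $A_1,A_2$ of a metric space $(X,d)$, $d(A_1,A_2)=\inf\{d(a_1,a_2)\mid a_1\in A_1,a_2\in A_2\}$. A finite family $\mathcal U$ of open sets in $X$ is a $\mathcal P$-cover of $X$ if $\bigcup_{U\in\mathcal U}U=X$ and the geometric realization of the nerve of $\mathcal U$ is homeomorphic to a member of $\mathcal P$. It is an $\varepsilon$-$\mathcal P$-cover if moreover each member has diameter less than $\varepsilon$. A continuum $X$ is $\mathcal P$-like if each open cover of $X$ can be refined by a finite open $\mathcal P$-cover of $X$. A family $\mathcal U$ of subsets of a metric space is taut if for all $U,V\in\mathcal U$ with $U\cap V=\emptyset$ one has $\operatorname{cl}(U)\cap\operatorname{cl}(V)=\emptyset$. The mesh of a family is the supremum of the diameters of its members. A family $\mathcal V$ strongly refines $\mathcal U$ if for each $V\in\mathcal V$ there is $U\in\mathcal U$ with $\operatorname{cl}(V)\subseteq U$. Fixed-point-free patterns: let $(\mathcal U_n)_{n\ge1}$ be a sequence of finite families of subsets of a metric space. Given functions $\varphi_n:\mathcal U_{n+1}\to\mathcal U_n$ ($n\ge 1$), consider the conditions: (D1) for all $U\in\mathcal U_1$, $V\in\mathcal U_2$: $U\cap V\ne\emptyset\Rightarrow\varphi_1(V)\cap U=\emptyset$; (D2) for each positive integer $n$ and all $U\in\mathcal U_{n+2}$, $V\in\mathcal U_{n+1}$: $U\cap V\neq\emptyset\Rightarrow\varphi_{n+1}(U)\cap\varphi_n(V)\ne\emptyset$;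 (D2') for each positive integer $n$ and all $U\in\mathcal U_{n+2}$, $V\in\mathcal U_{n+1}$: $\operatorname{cl}(U)\subseteq V\Rightarrow\varphi_{n+1}(U)\subseteq\varphi_n(V)$; (D3) for each positive integer $n$ and all $U,V\in\mathcal U_{n+1}$: $U\cap V\ne\emptyset\Rightarrow\varphi_n(U)\cap\varphi_n(V)\neq\emptyset$. The sequence $(\mathcal U_n)$ follows a fixed-point-free pattern if there is a sequence $(\varphi_n)$ of functions $\varphi_n:\mathcal U_{n+1}\to\mathcal U_n$ satisfying (D1), (D2) and (D3). It follows a type-(D2') fixed-point-free pattern if there is such a sequence $(\varphi_n)$ satisfying (D1), (D2') and (D3). *)

theory Defs
  imports "HOL-Analysis.Analysis"
begin

text \<open>
  Spaces are subsets \<open>X\<close> of a metric space type, with the restricted metric. Below \<open>X\<close> is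
  compact, hence closed, so the ambient \<^const>\<open>closure\<close> of a subset of \<open>X\<close> is its closure in \<open>X\<close>.
\<close>

definition continuum :: "'a::metric_space set \<Rightarrow> bool"
  where "continuum X \<longleftrightarrow> X \<noteq> {} \<and> compact X \<and> connected X"

definition fixed_point_property :: "'a::topological_space set \<Rightarrow> bool"
  where "fixed_point_property X \<longleftrightarrow>
    (\<forall>f. continuous_on X f \<and> f ` X \<subseteq> X \<longrightarrow> (\<exists>p\<in>X. f p = p))"

definition finite_abstract_complex :: "'v set set \<Rightarrow> bool"
  where "finite_abstract_complex K \<longleftrightarrow>
    finite K \<and> (\<forall>S\<in>K. finite S \<and> S \<noteq> {}) \<and> (\<forall>S\<in>K. \<forall>T. T \<subseteq> S \<and> T \<noteq> {} \<longrightarrow> T \<in> K)"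

text \<open>
  Points of the realization are given by their barycentric coordinates. The topology is the
  one inherited from the product topology on \<open>'v \<Rightarrow> real\<close>; for finite complexes this is the
  usual one.
\<close>

definition geometric_realization :: "'v set set \<Rightarrow> ('v \<Rightarrow> real) set"
  where "geometric_realization K =
    {x. (\<forall>v. 0 \<le> x v) \<and> {v. x v \<noteq> 0} \<in> K \<and> (\<Sum>v | x v \<noteq> 0. x v) = 1}"

definition nerve :: "'a set set \<Rightarrow> 'a set set set"
  where "nerve \<U> = {\<S>. \<S> \<subseteq> \<U> \<and> finite \<S> \<and> \<S> \<noteq> {} \<and> \<Inter>\<S> \<noteq> {}}"

text \<open>
  The library's \<^const>\<open>polyhedron\<close> is a convex intersection of half-spaces; here a polyhedron is
  a space triangulated by a finite simplicial complex. Vertices in \<open>nat\<close> suffice up to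
  isomorphism of complexes, and so do not bound the dimension.
\<close>

definition triangulable_polyhedron :: "'p::topological_space set \<Rightarrow> bool"
  where "triangulable_polyhedron Q \<longleftrightarrow>
    (\<exists>K::nat set set. finite_abstract_complex K \<and> Q homeomorphic geometric_realization K)"

definition P_cover :: "'p::topological_space set set \<Rightarrow> 'a::metric_space set \<Rightarrow> 'a set set \<Rightarrow> bool"
  where "P_cover \<P> X \<U> \<longleftrightarrow>
    finite \<U> \<and> (\<forall>U\<in>\<U>. openin (top_of_set X) U) \<and> \<Union>\<U> = X \<and>
    (\<exists>Q\<in>\<P>. geometric_realization (nerve \<U>) homeomorphic Q)"

definition eps_P_cover ::
    "real \<Rightarrow> 'p::topological_space set set \<Rightarrow> 'a::metric_space set \<Rightarrow> 'a set set \<Rightarrow> bool"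
  where "eps_P_cover \<epsilon> \<P> X \<U> \<longleftrightarrow> P_cover \<P> X \<U> \<and> (\<forall>U\<in>\<U>. diameter U < \<epsilon>)"

definition P_like :: "'p::topological_space set set \<Rightarrow> 'a::metric_space set \<Rightarrow> bool"
  where "P_like \<P> X \<longleftrightarrow> continuum X \<and>
    (\<forall>\<C>. (\<forall>C\<in>\<C>. openin (top_of_set X) C) \<and> \<Union>\<C> = X \<longrightarrow>
      (\<exists>\<U>. P_cover \<P> X \<U> \<and> (\<forall>U\<in>\<U>. \<exists>C\<in>\<C>. U \<subseteq> C)))"

definition taut :: "'a::metric_space set set \<Rightarrow> bool"
  where "taut \<U> \<longleftrightarrow> (\<forall>U\<in>\<U>. \<forall>V\<in>\<U>. U \<inter> V = {} \<longrightarrow> closure U \<inter> closure V = {})"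

definition mesh :: "'a::metric_space set set \<Rightarrow> real"
  where "mesh \<U> = (SUP U\<in>\<U>. diameter U)"

definition strongly_refines :: "'a::metric_space set set \<Rightarrow> 'a set set \<Rightarrow> bool"
  where "strongly_refines \<V> \<U> \<longleftrightarrow> (\<forall>V\<in>\<V>. \<exists>U\<in>\<U>. closure V \<subseteq> U)"

text \<open>
  Since \<open>setdist {} V = 0\<close> in the library whereas the infimum of the empty set of distances is
  infinite, a possible empty member does not enter the minimum. If no two nonempty members are
  disjoint, the value is unspecified; conditions (D1) and (D3) exclude this case for the first
  of a sequence of covers of a nonempty space.
\<close>

definition min_gap :: "'a::metric_space set set \<Rightarrow> real"
  where "min_gap \<U> =
    Min {setdist U V | U V. U \<in> \<U> \<and> V \<in> \<U> \<and> U \<noteq> {} \<and> V \<noteq> {} \<and> U \<inter> V = {}}"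

text \<open>Sequences are indexed from 1; the values at index 0 are irrelevant.\<close>

definition pattern_maps :: "(nat \<Rightarrow> 'a set set) \<Rightarrow> (nat \<Rightarrow> 'a set \<Rightarrow> 'a set) \<Rightarrow> bool"
  where "pattern_maps \<U> \<phi> \<longleftrightarrow> (\<forall>n\<ge>1. \<phi> n \<in> \<U> (n + 1) \<rightarrow> \<U> n)"

definition D1 :: "(nat \<Rightarrow> 'a set set) \<Rightarrow> (nat \<Rightarrow> 'a set \<Rightarrow> 'a set) \<Rightarrow> bool"
  where "D1 \<U> \<phi> \<longleftrightarrow> (\<forall>U\<in>\<U> 1. \<forall>V\<in>\<U> 2. U \<inter> V \<noteq> {} \<longrightarrow> \<phi> 1 V \<inter> U = {})"

definition D2 :: "(nat \<Rightarrow> 'a set set) \<Rightarrow> (nat \<Rightarrow> 'a set \<Rightarrow> 'a set) \<Rightarrow> bool"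
  where "D2 \<U> \<phi> \<longleftrightarrow> (\<forall>n\<ge>1. \<forall>U\<in>\<U> (n + 2). \<forall>V\<in>\<U> (n + 1).
    U \<inter> V \<noteq> {} \<longrightarrow> \<phi> (n + 1) U \<inter> \<phi> n V \<noteq> {})"

definition D2' :: "(nat \<Rightarrow> 'a::metric_space set set) \<Rightarrow> (nat \<Rightarrow> 'a set \<Rightarrow> 'a set) \<Rightarrow> bool"
  where "D2' \<U> \<phi> \<longleftrightarrow> (\<forall>n\<ge>1. \<forall>U\<in>\<U> (n + 2). \<forall>V\<in>\<U> (n + 1).
    closure U \<subseteq> V \<longrightarrow> \<phi> (n + 1) U \<subseteq> \<phi> n V)"

definition D3 :: "(nat \<Rightarrow> 'a set set) \<Rightarrow> (nat \<Rightarrow> 'a set \<Rightarrow> 'a set) \<Rightarrow> bool"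
  where "D3 \<U> \<phi> \<longleftrightarrow> (\<forall>n\<ge>1. \<forall>U\<in>\<U> (n + 1). \<forall>V\<in>\<U> (n + 1).
    U \<inter> V \<noteq> {} \<longrightarrow> \<phi> n U \<inter> \<phi> n V \<noteq> {})"

definition follows_fpf_pattern :: "(nat \<Rightarrow> 'a set set) \<Rightarrow> bool"
  where "follows_fpf_pattern \<U> \<longleftrightarrow> (\<exists>\<phi>. pattern_maps \<U> \<phi> \<and> D1 \<U> \<phi> \<and> D2 \<U> \<phi> \<and> D3 \<U> \<phi>)"

definition follows_D2'_fpf_pattern :: "(nat \<Rightarrow> 'a::metric_space set set) \<Rightarrow> bool"
  where "follows_D2'_fpf_pattern \<U> \<longleftrightarrow>
    (\<exists>\<phi>. pattern_maps \<U> \<phi> \<and> D1 \<U> \<phi> \<and> D2' \<U> \<phi> \<and> D3 \<U> \<phi>)"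

end

theory Submission
  imports Defs
begin

text \<open>
  A map \<open>f\<close> of \<open>X\<close> into itself and a pattern \<open>(\<phi>\<^sub>n)\<close> on finer and finer covers describe each
  other: \<open>\<phi>\<^sub>n V\<close> is a member of the \<open>n\<close>-th cover that approximates \<open>f ` V\<close>, and (D1) says that \<open>f\<close>
  moves every point off itself.

  From a map to a pattern. Let \<open>f\<close> have no fixed point. By compactness \<open>dist x (f x) \<ge> \<mu> > 0\<close> on \<open>X\<close>.
  If the members of the first cover have diameter below \<open>\<mu>/2\<close>, a member containing \<open>x\<close> and a member
  containing \<open>f x\<close> cannot meet, so any \<open>\<phi>\<^sub>1\<close> with \<open>f ` V \<subseteq> \<phi>\<^sub>1 V\<close> satisfies (D1). The inclusions
  \<open>f ` V \<subseteq> \<phi>\<^sub>n V\<close> alone give (D2) and (D3), because \<open>f x\<close> is a common point of the images of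
  members that share \<open>x\<close>. For (D2') it suffices to choose the next cover so fine that all
  of its members meeting \<open>f ` V\<close> lie in one member of the present cover
  (\<open>images_absorbed\<close>). Hence one sequence of covers has both kinds of pattern. Its covers come
  from \<open>P_like\<close> and are made taut by shrinking every member slightly
  (\<open>P_cover_taut_shrinking\<close>); the shrinking is so slight that the nerve, and hence the polyhedron
  that it realizes, stays the same.

  From a pattern to a map. For \<open>x \<in> X\<close> let \<open>C\<^sub>n x\<close> be the union of the \<open>\<phi>\<^sub>n V\<close> with \<open>x \<in> V\<close>. By (D3)
  its diameter is at most twice the mesh of the \<open>n\<close>-th cover. Either of (D2), (D2') says that a point
  of \<open>C\<^sub>n\<^sub>+\<^sub>1 x\<close> is close to \<open>C\<^sub>n x\<close>: within \<open>\<rho>/2\<^sup>n\<^sup>+\<^sup>1\<close> under (D2), and even inside it under (D2')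
  with strong refinement. So the sets \<open>C\<^sub>n x\<close> close down on one point \<open>f x\<close>, which depends
  continuously on \<open>x\<close> because points in a common member have nearby sets \<open>C\<^sub>n\<close>; this is
  \<open>limit_map\<close>. Here \<open>\<rho>\<close> is the least distance between disjoint members of the first cover.
  The errors add up to at most \<open>\<rho>/2\<close>, respectively \<open>0\<close>, so \<open>f x\<close> stays within \<open>\<rho>/2\<close> of \<open>\<phi>\<^sub>1 V\<close> for some \<open>V\<close> containing \<open>x\<close>, respectively in the closure of the union of
  all such \<open>\<phi>\<^sub>1 V\<close>. By (D1) these sets are disjoint from every member \<open>U\<close> of the first cover that
  contains \<open>x\<close>. So they are at distance at least \<open>\<rho>\<close> from \<open>U\<close>, and the closure of their union
  misses \<open>U\<close> because \<open>U\<close> is open in \<open>X\<close>. Either way \<open>f x \<noteq> x\<close>.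
\<close>

section \<open>Isomorphic nerves\<close>

text \<open>
  Barycentric coordinates are transported along the bijection of the vertices and are 0 elsewhere.
  In the product topology this is continuous because each coordinate of the image is a coordinate
  of the argument or constant.
\<close>

lemma geometric_realization_relabel:
  fixes K :: "'v set set" and g :: "'v \<Rightarrow> 'w"
  assumes inj: "inj_on g (\<Union>K)"
  shows "geometric_realization K homeomorphic geometric_realization ((`) g ` K)"
proof -
  define V where "V = \<Union>K"
  have inj: "inj_on g V" and in_V: "\<And>S. S \<in> K \<Longrightarrow> S \<subseteq> V"
    using assms by (auto simp: V_def)
  define h where "h = inv_into V g"
  define F where "F = (\<lambda>(x::'v \<Rightarrow> real) w. if w \<in> g ` V then x (h w) else 0)"
  define G where "G = (\<lambda>(y::'w \<Rightarrow> real) v. if v \<in> V then y (g v) else 0)"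
  have hg: "h (g v) = v" if "v \<in> V" for v
    unfolding h_def using inj that by (rule inv_into_f_f)
  have suppF: "{w. F x w \<noteq> 0} = g ` {v. x v \<noteq> 0}" if "{v. x v \<noteq> 0} \<subseteq> V" for x
  proof (intro equalityI subsetI)
    fix w assume "w \<in> {w. F x w \<noteq> 0}"
    then obtain v where "v \<in> V" "w = g v" "x (h w) \<noteq> 0"
      unfolding F_def by (auto split: if_splits)
    then show "w \<in> g ` {v. x v \<noteq> 0}" using hg[of v] by auto
  next
    fix w assume "w \<in> g ` {v. x v \<noteq> 0}"
    then obtain v where "x v \<noteq> 0" "w = g v" by blast
    moreover then have "v \<in> V" using that by blast
    ultimately show "w \<in> {w. F x w \<noteq> 0}" using hg[of v] by (auto simp: F_def)
  qed
  have suppG: "{v. G y v \<noteq> 0} = S" if "{w. y w \<noteq> 0} = g ` S" "S \<subseteq> V" for y S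
  proof -
    have "{v. G y v \<noteq> 0} = {v \<in> V. g v \<in> g ` S}"
      using that(1) unfolding G_def by auto
    also have "\<dots> = S"
      using inj that(2) by (auto simp: inj_on_def)
    finally show ?thesis .
  qed
  have F_in: "F x \<in> geometric_realization ((`) g ` K)" and GF: "G (F x) = x"
    if "x \<in> geometric_realization K" for x
  proof -
    let ?S = "{v. x v \<noteq> 0}"
    have x: "\<And>v. 0 \<le> x v" "?S \<in> K" "sum x ?S = 1"
      using that by (auto simp: geometric_realization_def)
    then have sub: "?S \<subseteq> V" using in_V by blast
    have "sum (F x) (g ` ?S) = sum (F x \<circ> g) ?S"
      by (rule sum.reindex) (rule inj_on_subset[OF inj sub])
    also have "\<dots> = sum x ?S"
      by (intro sum.cong refl) (use sub hg in \<open>auto simp: F_def subset_iff\<close>)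
    finally have "sum (F x) (g ` ?S) = 1" using x by simp
    then show "F x \<in> geometric_realization ((`) g ` K)"
      using x suppF[OF sub] by (auto simp: geometric_realization_def F_def)
    show "G (F x) = x"
    proof
      fix v show "G (F x) v = x v"
        using sub hg[of v] by (cases "v \<in> V") (auto simp: G_def F_def)
    qed
  qed
  have G_in: "G y \<in> geometric_realization K" and FG: "F (G y) = y"
    if "y \<in> geometric_realization ((`) g ` K)" for y
  proof -
    let ?T = "{w. y w \<noteq> 0}"
    have y: "\<And>w. 0 \<le> y w" "?T \<in> (`) g ` K" "sum y ?T = 1"
      using that by (auto simp: geometric_realization_def)
    then obtain S where S: "S \<in> K" "?T = g ` S" by auto
    then have sub: "S \<subseteq> V" using in_V by blast
    have "sum y ?T = sum (y \<circ> g) S"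
      unfolding S(2) by (rule sum.reindex) (rule inj_on_subset[OF inj sub])
    also have "\<dots> = sum (G y) S"
      using sub by (intro sum.cong) (auto simp: G_def)
    finally have "sum (G y) S = 1" using y by simp
    then show "G y \<in> geometric_realization K"
      using y S suppG[OF S(2) sub] by (auto simp: geometric_realization_def G_def)
    show "F (G y) = y"
    proof
      fix w show "F (G y) w = y w"
      proof (cases "w \<in> g ` V")
        case True
        then show ?thesis using hg by (auto simp: F_def G_def)
      next
        case False
        then have "w \<notin> ?T" using S sub by blast
        then show ?thesis using False by (auto simp: F_def)
      qed
    qed
  qed
  have coord: "continuous_on S (\<lambda>x::'c \<Rightarrow> real. x i)" for S i
    by (rule continuous_on_subset[OF continuous_on_product_coordinates]) simp
  have cF: "continuous_on S F" for S
  proof (rule continuous_on_coordinatewise_then_product)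
    show "continuous_on S (\<lambda>x. F x i)" for i
      unfolding F_def by (cases "i \<in> g ` V") (simp_all add: coord)
  qed
  have cG: "continuous_on S G" for S
  proof (rule continuous_on_coordinatewise_then_product)
    show "continuous_on S (\<lambda>x. G x i)" for i
      unfolding G_def by (cases "i \<in> V") (simp_all add: coord)
  qed
  have "homeomorphism (geometric_realization K) (geometric_realization ((`) g ` K)) F G"
    by (rule homeomorphismI) (use cF cG F_in G_in GF FG in auto)
  then show ?thesis unfolding homeomorphic_def by blast
qed

text \<open>
  The nerve of the image family is the image of the nerve under relabelling of the vertices; injectivity
  of \<open>h\<close> is what keeps distinct vertices apart, since a family is a plain set of sets.
\<close>

lemma P_cover_relabel:
  assumes cov: "P_cover \<P> X \<U>"
    and opn: "\<And>U. U \<in> \<U> \<Longrightarrow> openin (top_of_set X) (h U)"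
    and un: "\<Union>(h ` \<U>) = X"
    and inj: "inj_on h \<U>"
    and same: "\<And>\<S>. \<S> \<subseteq> \<U> \<Longrightarrow> \<S> \<noteq> {} \<Longrightarrow> \<Inter>(h ` \<S>) \<noteq> {} \<longleftrightarrow> \<Inter>\<S> \<noteq> {}"
  shows "P_cover \<P> X (h ` \<U>)"
proof -
  have "nerve (h ` \<U>) = (`) h ` nerve \<U>"
  proof (intro equalityI subsetI)
    fix \<T> assume \<T>: "\<T> \<in> nerve (h ` \<U>)"
    then obtain \<S> where \<S>: "\<S> \<subseteq> \<U>" "\<T> = h ` \<S>"
      by (auto simp: nerve_def subset_image_iff)
    then have "\<S> \<in> nerve \<U>"
      using \<T> same[of \<S>] inj_on_subset[OF inj \<S>(1)]
      by (auto simp: nerve_def finite_image_iff)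
    then show "\<T> \<in> (`) h ` nerve \<U>" using \<S> by blast
  next
    fix \<T> assume "\<T> \<in> (`) h ` nerve \<U>"
    then obtain \<S> where "\<S> \<in> nerve \<U>" "\<T> = h ` \<S>" by blast
    then show "\<T> \<in> nerve (h ` \<U>)" using same[of \<S>] by (auto simp: nerve_def)
  qed
  moreover have "\<Union>(nerve \<U>) \<subseteq> \<U>" by (auto simp: nerve_def)
  ultimately have "geometric_realization (nerve (h ` \<U>)) homeomorphic geometric_realization (nerve \<U>)"
    using geometric_realization_relabel[of h "nerve \<U>"] inj_on_subset[OF inj]
    by (metis homeomorphic_sym)
  then show ?thesis
    using cov opn un unfolding P_cover_def by (auto intro: homeomorphic_trans)
qed

section \<open>Taut shrinkings\<close>

text \<open>
  The form of the Lebesgue number lemma that suits covers by relatively open sets.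
\<close>

lemma relative_Lebesgue_number:
  fixes X :: "'a::metric_space set"
  assumes "compact X" and opn: "\<And>C. C \<in> \<C> \<Longrightarrow> openin (top_of_set X) C" and un: "\<Union>\<C> = X"
  obtains \<epsilon> where "0 < \<epsilon>" "\<And>x. x \<in> X \<Longrightarrow> \<exists>C\<in>\<C>. X \<inter> ball x \<epsilon> \<subseteq> C"
proof -
  let ?G = "{T. open T \<and> (\<exists>C\<in>\<C>. X \<inter> T \<subseteq> C)}"
  have "X \<subseteq> \<Union>?G"
  proof
    fix x assume "x \<in> X"
    then obtain C where C: "C \<in> \<C>" "x \<in> C" using un by blast
    then obtain T where "open T" "C = X \<inter> T" using opn by (meson openin_open)
    then show "x \<in> \<Union>?G" using C by auto
  qed
  then obtain \<epsilon> where \<epsilon>: "0 < \<epsilon>" "\<And>x. x \<in> X \<Longrightarrow> \<exists>T\<in>?G. ball x \<epsilon> \<subseteq> T"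
  proof (rule Heine_Borel_lemma[OF \<open>compact X\<close>])
  qed auto
  show ?thesis
  proof (rule that[OF \<epsilon>(1)])
    fix x assume "x \<in> X"
    then obtain T C where "C \<in> \<C>" "X \<inter> T \<subseteq> C" "ball x \<epsilon> \<subseteq> T" using \<epsilon>(2)[of x] by auto
    then show "\<exists>C\<in>\<C>. X \<inter> ball x \<epsilon> \<subseteq> C" by (intro bexI[of _ C]) auto
  qed
qed

text \<open>
  The radius is bounded below strictly, which makes the set open. For \<open>U \<subset> X\<close> it consists of the
  points of \<open>X\<close> at distance more than \<open>\<epsilon>\<close> from \<open>X - U\<close>, and for \<open>U = X\<close> it is \<open>X\<close>.
\<close>

definition shrink :: "'a::metric_space set \<Rightarrow> real \<Rightarrow> 'a set \<Rightarrow> 'a set"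
  where "shrink X \<epsilon> U = {x \<in> X. \<exists>r>\<epsilon>. X \<inter> ball x r \<subseteq> U}"

lemma shrink_subset: "0 < \<epsilon> \<Longrightarrow> shrink X \<epsilon> U \<subseteq> U"
  unfolding shrink_def by force

lemma openin_shrink: "openin (top_of_set X) (shrink X \<epsilon> U)"
  unfolding openin_euclidean_subtopology_iff
proof (intro conjI ballI)
  fix x assume "x \<in> shrink X \<epsilon> U"
  then obtain r where r: "x \<in> X" "r > \<epsilon>" "X \<inter> ball x r \<subseteq> U" by (auto simp: shrink_def)
  have "y \<in> shrink X \<epsilon> U" if "y \<in> X" "dist y x < (r - \<epsilon>) / 2" for y
  proof -
    have "ball y ((r + \<epsilon>) / 2) \<subseteq> ball x r"
    proof
      fix z assume "z \<in> ball y ((r + \<epsilon>) / 2)"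
      then have "dist y z < (r + \<epsilon>) / 2" "dist x y < (r - \<epsilon>) / 2"
        using that(2) by (simp_all add: dist_commute)
      then have "dist x z < r" using dist_triangle[of x z y] by argo
      then show "z \<in> ball x r" by simp
    qed
    moreover have "(r + \<epsilon>) / 2 > \<epsilon>" using r by simp
    ultimately show ?thesis using that r unfolding shrink_def by blast
  qed
  then show "\<exists>e>0. \<forall>y\<in>X. dist y x < e \<longrightarrow> y \<in> shrink X \<epsilon> U"
    using r by (intro exI[of _ "(r - \<epsilon>) / 2"]) auto
qed (auto simp: shrink_def)

lemma closure_shrink_subset:
  assumes "closed X" "0 < \<epsilon>"
  shows "closure (shrink X \<epsilon> U) \<subseteq> U"
proof
  fix y assume y: "y \<in> closure (shrink X \<epsilon> U)"
  then have "y \<in> X"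
    using closure_minimal[OF _ \<open>closed X\<close>, of "shrink X \<epsilon> U"] by (auto simp: shrink_def)
  obtain x where "x \<in> shrink X \<epsilon> U" "dist x y < \<epsilon>"
    using y \<open>0 < \<epsilon>\<close> by (auto simp: closure_approachable)
  then show "y \<in> U" using \<open>y \<in> X\<close> unfolding shrink_def by force
qed

text \<open>
  Keep a finite set \<open>P\<close> of witnesses: a point of each nonempty intersection of members, and a
  point that tells each two members apart. For small \<open>\<epsilon>\<close> the sets \<open>shrink X \<epsilon> U\<close> still cover \<open>X\<close>
  and still contain the points of \<open>P \<inter> U\<close>. Then they intersect exactly when the original members
  do and are pairwise different, so the nerve is unchanged. Tautness is now automatic: if two shrunk
  members are disjoint, so are the original ones, and these contain the closures.
  An empty member is dropped first; it is no vertex of the nerve.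
\<close>

lemma P_cover_taut_shrinking:
  fixes X :: "'a::metric_space set"
  assumes "compact X" and cov: "P_cover \<P> X \<U>"
  obtains \<V> where "P_cover \<P> X \<V>" "taut \<V>" "{} \<notin> \<V>" "strongly_refines \<V> \<U>"
proof -
  define \<W> where "\<W> = \<U> - {{}}"
  have "nerve \<W> = nerve \<U>" unfolding nerve_def \<W>_def by auto
  then have covW: "P_cover \<P> X \<W>"
    using cov unfolding P_cover_def \<W>_def by auto
  then have fin: "finite \<W>" and opn: "\<And>U. U \<in> \<W> \<Longrightarrow> openin (top_of_set X) U"
    and un: "\<Union>\<W> = X"
    by (auto simp: P_cover_def)
  \<comment> \<open>The choices from empty sets only add irrelevant points to \<open>P\<close>.\<close>
  define P where "P = (\<lambda>\<S>. SOME x. x \<in> \<Inter>\<S>) ` Pow \<W> \<union>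
      (\<lambda>(U, V). SOME x. x \<in> U - V \<union> (V - U)) ` (\<W> \<times> \<W>)"
  have "finite P" unfolding P_def using fin by auto
  have P_inter: "\<exists>p\<in>P. p \<in> \<Inter>\<S>" if "\<S> \<subseteq> \<W>" "\<Inter>\<S> \<noteq> {}" for \<S>
  proof (rule bexI)
    show "(SOME x. x \<in> \<Inter>\<S>) \<in> \<Inter>\<S>" by (rule some_in_eq[THEN iffD2]) fact
  qed (use that in \<open>auto simp: P_def\<close>)
  have P_diff: "\<exists>p\<in>P. p \<in> U - V \<union> (V - U)" if "U \<in> \<W>" "V \<in> \<W>" "U \<noteq> V" for U V
  proof (rule bexI)
    show "(SOME x. x \<in> U - V \<union> (V - U)) \<in> U - V \<union> (V - U)"
      by (rule some_in_eq[THEN iffD2]) (use that in blast)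
  qed (use that in \<open>force simp: P_def\<close>)
  have "\<forall>\<^sub>F \<epsilon> in at_right 0. \<forall>p\<in>P. \<forall>U\<in>\<W>. p \<in> U \<longrightarrow> p \<in> shrink X \<epsilon> U"
  proof (intro eventually_ball_finite \<open>finite P\<close> fin ballI)
    fix p U assume "p \<in> P" "U \<in> \<W>"
    show "\<forall>\<^sub>F \<epsilon> in at_right 0. p \<in> U \<longrightarrow> p \<in> shrink X \<epsilon> U"
    proof (cases "p \<in> U")
      case True
      obtain r where r: "r > 0" "X \<inter> ball p r \<subseteq> U" "p \<in> X"
        using opn[OF \<open>U \<in> \<W>\<close>] True unfolding openin_contains_ball by (metis Int_commute subsetD)
      then show ?thesis
        unfolding shrink_def eventually_at_right_field by (intro exI[of _ r]) auto
    qed auto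
  qed
  moreover have "\<forall>\<^sub>F \<epsilon> in at_right 0. \<forall>x\<in>X. \<exists>U\<in>\<W>. x \<in> shrink X \<epsilon> U"
  proof -
    obtain r where r: "r > 0" "\<And>x. x \<in> X \<Longrightarrow> \<exists>U\<in>\<W>. X \<inter> ball x r \<subseteq> U"
      using relative_Lebesgue_number[OF \<open>compact X\<close> opn un] by blast
    have "\<exists>U\<in>\<W>. x \<in> shrink X \<epsilon> U" if "\<epsilon> < r" "x \<in> X" for \<epsilon> x
      using r(2)[OF that(2)] that unfolding shrink_def by blast
    then show ?thesis
      unfolding eventually_at_right_field using r(1) by blast
  qed
  moreover have "\<forall>\<^sub>F \<epsilon> in at_right (0::real). 0 < \<epsilon>"
    by (rule eventually_at_right_less)
  ultimately have "\<forall>\<^sub>F \<epsilon> in at_right (0::real). 0 < \<epsilon> \<and> (\<forall>x\<in>X. \<exists>U\<in>\<W>. x \<in> shrink X \<epsilon> U)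
      \<and> (\<forall>p\<in>P. \<forall>U\<in>\<W>. p \<in> U \<longrightarrow> p \<in> shrink X \<epsilon> U)"
    by eventually_elim blast
  then have "\<exists>\<epsilon>. 0 < \<epsilon> \<and> (\<forall>x\<in>X. \<exists>U\<in>\<W>. x \<in> shrink X \<epsilon> U)
      \<and> (\<forall>p\<in>P. \<forall>U\<in>\<W>. p \<in> U \<longrightarrow> p \<in> shrink X \<epsilon> U)"
    by (rule eventually_happens'[OF trivial_limit_at_right_real])
  then obtain \<epsilon> where "0 < \<epsilon> \<and> (\<forall>x\<in>X. \<exists>U\<in>\<W>. x \<in> shrink X \<epsilon> U)
      \<and> (\<forall>p\<in>P. \<forall>U\<in>\<W>. p \<in> U \<longrightarrow> p \<in> shrink X \<epsilon> U)"
    by (rule exE)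
  then have \<epsilon>: "0 < \<epsilon>" "\<And>x. x \<in> X \<Longrightarrow> \<exists>U\<in>\<W>. x \<in> shrink X \<epsilon> U"
      "\<And>p U. p \<in> P \<Longrightarrow> U \<in> \<W> \<Longrightarrow> p \<in> U \<Longrightarrow> p \<in> shrink X \<epsilon> U"
    by simp_all
  let ?h = "shrink X \<epsilon>"
  have sub: "?h U \<subseteq> U" for U
    by (rule shrink_subset[OF \<epsilon>(1)])
  have cl: "closure (?h U) \<subseteq> U" for U
    by (rule closure_shrink_subset[OF compact_imp_closed[OF \<open>compact X\<close>] \<epsilon>(1)])
  have same: "\<Inter>(?h ` \<S>) \<noteq> {} \<longleftrightarrow> \<Inter>\<S> \<noteq> {}" if \<S>: "\<S> \<subseteq> \<W>" for \<S>
  proof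
    assume "\<Inter>(?h ` \<S>) \<noteq> {}"
    moreover have "\<Inter>(?h ` \<S>) \<subseteq> \<Inter>\<S>" using sub by fast
    ultimately show "\<Inter>\<S> \<noteq> {}" by auto
  next
    assume "\<Inter>\<S> \<noteq> {}"
    then obtain p where p: "p \<in> P" "p \<in> \<Inter>\<S>" using P_inter[OF \<S>] by auto
    have "p \<in> ?h U" if "U \<in> \<S>" for U
      using \<epsilon>(3)[OF p(1), of U] p(2) that \<S> by auto
    then have "p \<in> \<Inter>(?h ` \<S>)" by (rule INT_I)
    then show "\<Inter>(?h ` \<S>) \<noteq> {}" by blast
  qed
  have inj: "inj_on ?h \<W>"
  proof (rule inj_onI, rule ccontr)
    fix U V assume *: "U \<in> \<W>" "V \<in> \<W>" "?h U = ?h V" "U \<noteq> V"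
    then obtain p where "p \<in> P" "p \<in> U - V \<union> (V - U)" using P_diff by blast
    then show False using * \<epsilon>(3)[of p] sub[of U] sub[of V] by blast
  qed
  have ne: "?h U \<noteq> {}" if "U \<in> \<W>" for U
    using same[of "{U}"] that unfolding \<W>_def by auto
  show ?thesis
  proof (rule that)
    show "P_cover \<P> X (?h ` \<W>)"
    proof (rule P_cover_relabel[OF covW openin_shrink _ inj])
      show "\<Union>(?h ` \<W>) = X" using \<epsilon>(2) by (auto simp: shrink_def)
    qed (rule same)
    show "taut (?h ` \<W>)"
      unfolding taut_def
    proof (clarify)
      fix U V assume *: "U \<in> \<W>" "V \<in> \<W>" "?h U \<inter> ?h V = {}"
      then have "U \<inter> V = {}" using same[of "{U, V}"] by auto
      then show "closure (?h U) \<inter> closure (?h V) = {}" using cl by blast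
    qed
    show "{} \<notin> ?h ` \<W>" using ne by blast
    show "strongly_refines (?h ` \<W>) \<U>"
      unfolding strongly_refines_def \<W>_def using cl by blast
  qed
qed

section \<open>Covers that follow a fixed-point-free map\<close>

text \<open>
  If \<open>\<V>\<close> covers the image of \<open>f\<close>, this says more than \<open>f ` A \<subseteq> B\<close>: every member of \<open>\<V>\<close> that contains
  the image of a nonempty subset of \<open>A\<close> also lies in \<open>B\<close>. This room around \<open>f ` A\<close> is what
  condition (D2') needs.
\<close>

definition images_absorbed :: "('a \<Rightarrow> 'a) \<Rightarrow> 'a set set \<Rightarrow> 'a set set \<Rightarrow> bool"
  where "images_absorbed f \<V> \<U> \<longleftrightarrow>
    (\<forall>A\<in>\<V>. \<exists>B\<in>\<U>. \<forall>W\<in>\<V>. W \<inter> f ` A \<noteq> {} \<longrightarrow> W \<subseteq> B)"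

lemma dist_le_diameter:
  fixes X :: "'a::metric_space set"
  assumes "compact X" "A \<subseteq> X" "x \<in> A" "y \<in> A"
  shows "dist x y \<le> diameter A"
  using assms by (meson bounded_subset compact_imp_bounded diameter_bounded_bound)

lemma diameter_le_of_subset_ball:
  fixes A :: "'a::metric_space set"
  assumes "A \<subseteq> ball x \<delta>" "0 < \<delta>"
  shows "diameter A \<le> 2 * \<delta>"
  unfolding diameter_def
proof (split if_split, intro conjI impI)
  assume "A \<noteq> {}"
  then show "(SUP (y, z)\<in>A \<times> A. dist y z) \<le> 2 * \<delta>"
  proof (intro cSUP_least)
    fix p assume p: "p \<in> A \<times> A"
    then have "dist x (fst p) < \<delta>" "dist x (snd p) < \<delta>" using assms by auto
    then show "(case p of (y, z) \<Rightarrow> dist y z) \<le> 2 * \<delta>"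
      using dist_triangle3[of "fst p" "snd p" x] by (simp add: case_prod_beta)
  qed auto
qed (use assms in auto)

text \<open>
  Let \<open>\<epsilon>\<close> be a Lebesgue number of \<open>\<U>\<close>. Members of \<open>\<V>\<close> of diameter below \<open>\<epsilon>/2\<close> whose \<open>f\<close>-images
  lie in balls of radius \<open>\<epsilon>/2\<close> do the job: a member meeting such an image lies in the ball of
  radius \<open>\<epsilon>\<close> with the same centre, hence in one member of \<open>\<U>\<close>.
\<close>

lemma P_like_refinement:
  fixes X :: "'a::metric_space set"
  assumes like: "P_like \<P> X" and cont: "continuous_on X f" and fX: "f ` X \<subseteq> X"
    and opn: "\<And>U. U \<in> \<U> \<Longrightarrow> openin (top_of_set X) U" and un: "\<Union>\<U> = X" and "0 < e"
  obtains \<V> where "P_cover \<P> X \<V>" "taut \<V>" "{} \<notin> \<V>" "strongly_refines \<V> \<U>"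
    "\<forall>A\<in>\<V>. diameter A < e" "images_absorbed f \<V> \<U>"
proof -
  have comp: "compact X" using like by (simp add: P_like_def continuum_def)
  obtain \<epsilon> where \<epsilon>: "0 < \<epsilon>" "\<And>x. x \<in> X \<Longrightarrow> \<exists>U\<in>\<U>. X \<inter> ball x \<epsilon> \<subseteq> U"
    using relative_Lebesgue_number[OF comp opn un] by blast
  \<comment> \<open>A set in a ball of radius \<open>\<delta>\<close> has diameter at most \<open>2 * \<delta>\<close>, which has to be below both \<open>e\<close>
    and \<open>\<epsilon> / 2\<close>.\<close>
  define \<delta> where "\<delta> = min e \<epsilon> / 5"
  have \<delta>: "0 < \<delta>" "2 * \<delta> < e" "2 * \<delta> < \<epsilon> / 2" "\<delta> \<le> \<epsilon>"
    using \<epsilon> \<open>0 < e\<close> by (auto simp: \<delta>_def min_def)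
  define C where "C = (\<lambda>x. X \<inter> ball x \<delta> \<inter> (X \<inter> f -` ball (f x) (\<epsilon> / 2)))"
  have "openin (top_of_set X) (C x)" for x
    unfolding C_def
    by (intro openin_Int openin_open_Int continuous_openin_preimage_gen[OF cont] open_ball)
  moreover have "\<Union>(C ` X) = X" using \<delta> \<epsilon> by (auto simp: C_def)
  ultimately have "\<exists>\<W>. P_cover \<P> X \<W> \<and> (\<forall>U\<in>\<W>. \<exists>B\<in>C ` X. U \<subseteq> B)"
    using like[unfolded P_like_def, THEN conjunct2, THEN spec, of "C ` X"] by (simp only: ball_simps) simp
  then obtain \<W> where \<W>: "P_cover \<P> X \<W>" "\<forall>U\<in>\<W>. \<exists>x\<in>X. U \<subseteq> C x"
    by auto
  obtain \<V> where \<V>: "P_cover \<P> X \<V>" "taut \<V>" "{} \<notin> \<V>" "strongly_refines \<V> \<W>"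
    using P_cover_taut_shrinking[OF comp \<W>(1)] by blast
  have inC: "\<exists>x\<in>X. closure A \<subseteq> C x" if "A \<in> \<V>" for A
    using \<V>(4) \<W>(2) that unfolding strongly_refines_def by (meson subset_trans)
  have sub: "A \<subseteq> X" if "A \<in> \<V>" for A using \<V>(1) that by (auto simp: P_cover_def)
  have diam: "diameter A \<le> 2 * \<delta>" if A: "A \<in> \<V>" for A
  proof -
    obtain x where "closure A \<subseteq> C x" using inC[OF A] by blast
    then have "A \<subseteq> ball x \<delta>" using closure_subset by (fastforce simp: C_def)
    then show ?thesis using diameter_le_of_subset_ball \<delta>(1) by blast
  qed
  have refn: "strongly_refines \<V> \<U>"
    unfolding strongly_refines_def
  proof
    fix A assume "A \<in> \<V>"
    then obtain x where x: "x \<in> X" "closure A \<subseteq> C x" using inC by blast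
    obtain U where "U \<in> \<U>" "X \<inter> ball x \<epsilon> \<subseteq> U" using \<epsilon> x by blast
    moreover have "C x \<subseteq> X \<inter> ball x \<epsilon>" using \<delta>(4) by (auto simp: C_def)
    ultimately show "\<exists>U\<in>\<U>. closure A \<subseteq> U" using x by blast
  qed
  have abso: "images_absorbed f \<V> \<U>"
    unfolding images_absorbed_def
  proof
    fix A assume "A \<in> \<V>"
    then obtain x where x: "x \<in> X" "closure A \<subseteq> C x" using inC by blast
    then obtain U where U: "U \<in> \<U>" "X \<inter> ball (f x) \<epsilon> \<subseteq> U" using \<epsilon> fX by blast
    have "W \<subseteq> U" if W: "W \<in> \<V>" "W \<inter> f ` A \<noteq> {}" for W
    proof
      fix w assume w: "w \<in> W"
      obtain a where a: "a \<in> A" "f a \<in> W" using W by blast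
      then have "a \<in> C x" using x closure_subset by blast
      then have "dist (f x) (f a) < \<epsilon> / 2" by (simp add: C_def)
      moreover have "dist (f a) w \<le> 2 * \<delta>"
        using dist_le_diameter[OF comp sub[OF W(1)] a(2) w] diam[OF W(1)] by simp
      ultimately have "w \<in> ball (f x) \<epsilon>"
        using dist_triangle[of "f x" w "f a"] \<delta>(3) by simp
      then show "w \<in> U" using U sub W w by blast
    qed
    then show "\<exists>U\<in>\<U>. \<forall>W\<in>\<V>. W \<inter> f ` A \<noteq> {} \<longrightarrow> W \<subseteq> U" using U by blast
  qed
  show ?thesis
    using \<V> refn abso diam \<delta>(2) by (intro that[of \<V>]) (auto intro: le_less_trans)
qed

lemma finite_gaps:
  assumes "finite \<U>"
  shows "finite {setdist U V | U V. U \<in> \<U> \<and> V \<in> \<U> \<and> U \<noteq> {} \<and> V \<noteq> {} \<and> U \<inter> V = {}}"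
  by (rule finite_subset[of _ "(\<lambda>(U, V). setdist U V) ` (\<U> \<times> \<U>)"]) (use assms in auto)

lemma min_gap_le:
  assumes "finite \<U>" "U \<in> \<U>" "V \<in> \<U>" "U \<noteq> {}" "V \<noteq> {}" "U \<inter> V = {}"
  shows "min_gap \<U> \<le> setdist U V"
  unfolding min_gap_def by (rule Min_le[OF finite_gaps]) (use assms in auto)

lemma setdist_pos_of_disjoint_closures:
  fixes U V :: "'a::metric_space set"
  assumes "compact (closure U)" "closure U \<inter> closure V = {}" "U \<noteq> {}" "V \<noteq> {}"
  shows "0 < setdist U V"
proof -
  obtain \<epsilon> where \<epsilon>: "0 < \<epsilon>" "\<And>x. x \<in> closure U \<Longrightarrow> ball x \<epsilon> \<subseteq> - closure V"
    using Heine_Borel_lemma[OF assms(1), of "{- closure V}"] assms(2) by auto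
  have "\<epsilon> \<le> dist x y" if "x \<in> U" "y \<in> V" for x y
  proof (rule ccontr)
    assume "\<not> \<epsilon> \<le> dist x y"
    then have "y \<in> ball x \<epsilon>" by simp
    then show False using \<epsilon>(2)[of x] that closure_subset[of U] closure_subset[of V] by blast
  qed
  then have "\<epsilon> \<le> setdist U V" using assms(3,4) by (simp add: le_setdist_iff)
  then show ?thesis using \<epsilon> by simp
qed

text \<open>
  Tautness is what makes the gap positive: in a compact space disjoint closures have positive distance. The
  disjoint pair \<open>U\<close>, \<open>V\<close> ensures that the minimum is taken over a nonempty set.
\<close>

lemma min_gap_pos:
  fixes X :: "'a::metric_space set"
  assumes "compact X" "finite \<U>" "taut \<U>" "\<Union>\<U> \<subseteq> X"
    and ex: "U \<in> \<U>" "V \<in> \<U>" "U \<noteq> {}" "V \<noteq> {}" "U \<inter> V = {}"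
  shows "0 < min_gap \<U>"
proof -
  have "0 < setdist A B" if "A \<in> \<U>" "B \<in> \<U>" "A \<noteq> {}" "B \<noteq> {}" "A \<inter> B = {}" for A B
  proof (rule setdist_pos_of_disjoint_closures)
    have "closure A \<subseteq> X"
      using that assms by (intro closure_minimal compact_imp_closed) auto
    then show "compact (closure A)"
      using compact_Int_closed[OF \<open>compact X\<close> closed_closure[of A]] by (simp add: inf.absorb2)
    show "closure A \<inter> closure B = {}" using \<open>taut \<U>\<close> that unfolding taut_def by blast
  qed (use that in auto)
  then show ?thesis
    unfolding min_gap_def using ex by (subst Min_gr_iff[OF finite_gaps[OF \<open>finite \<U>\<close>]]) auto
qed

lemma mesh_tendsto_0:
  fixes \<U> :: "nat \<Rightarrow> 'a::metric_space set set"
  assumes X: "compact X" "X \<noteq> {}" and cov: "\<And>n. n \<ge> 1 \<Longrightarrow> P_cover \<P> X (\<U> n)"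
    and small: "\<And>n A. n \<ge> 2 \<Longrightarrow> A \<in> \<U> n \<Longrightarrow> diameter A \<le> c / 2 ^ n"
  shows "(\<lambda>n. mesh (\<U> n)) \<longlonglongrightarrow> 0"
proof (rule tendsto_sandwich)
  have bounds: "0 \<le> mesh (\<U> n) \<and> mesh (\<U> n) \<le> c / 2 ^ n" if n: "n \<ge> 2" for n
  proof -
    have cn: "finite (\<U> n)" "\<Union>(\<U> n) = X" using cov[of n] n by (auto simp: P_cover_def)
    then obtain A where A: "A \<in> \<U> n" using X by blast
    then have "bounded A"
      using cn X by (meson Union_upper bounded_subset compact_imp_bounded subset_trans order_refl)
    then have "0 \<le> diameter A" by (rule diameter_ge_0)
    also have "\<dots> \<le> mesh (\<U> n)"
      unfolding mesh_def by (rule cSUP_upper[OF A]) (use cn in auto)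
    finally have "0 \<le> mesh (\<U> n)" .
    moreover have "mesh (\<U> n) \<le> c / 2 ^ n"
      unfolding mesh_def by (rule cSUP_least) (use A small n in auto)
    ultimately show ?thesis by blast
  qed
  show "\<forall>\<^sub>F n in sequentially. 0 \<le> mesh (\<U> n)"
    using bounds by (auto simp: eventually_sequentially)
  show "\<forall>\<^sub>F n in sequentially. mesh (\<U> n) \<le> c / 2 ^ n"
    using bounds by (auto simp: eventually_sequentially)
  show "(\<lambda>n. c / 2 ^ n) \<longlonglongrightarrow> 0"
    using tendsto_mult[OF tendsto_const[of c] LIMSEQ_inverse_realpow_zero[of 2]]
    by (simp add: divide_inverse)
qed simp

text \<open>
  The first cover has to be fixed before the others, because the required diameters of the later
  ones depend on its gap. Its mesh below \<open>\<mu>/2\<close> gives (D1) and also the disjoint pair that makes this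
  gap positive. The remaining covers are chosen recursively by \<open>P_like_refinement\<close>.
\<close>

proposition covers_following_fixed_point_free_map:
  fixes X :: "'a::metric_space set"
  assumes like: "P_like \<P> X" and nfpp: "\<not> fixed_point_property X"
  obtains \<U> :: "nat \<Rightarrow> 'a set set" and \<phi> where
    "\<And>n. n \<ge> 1 \<Longrightarrow> P_cover \<P> X (\<U> n)" "\<And>n. n \<ge> 1 \<Longrightarrow> taut (\<U> n)"
    "\<And>n. n \<ge> 1 \<Longrightarrow> strongly_refines (\<U> (n + 1)) (\<U> n)"
    "\<And>n A. n \<ge> 2 \<Longrightarrow> A \<in> \<U> n \<Longrightarrow> diameter A < min_gap (\<U> 1) / 2 ^ n"
    "pattern_maps \<U> \<phi>" "D1 \<U> \<phi>" "D2 \<U> \<phi>" "D2' \<U> \<phi>" "D3 \<U> \<phi>"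
proof -
  obtain f where cont: "continuous_on X f" and fX: "f ` X \<subseteq> X"
    and free: "\<And>p. p \<in> X \<Longrightarrow> f p \<noteq> p"
    using nfpp unfolding fixed_point_property_def by blast
  have comp: "compact X" and "X \<noteq> {}" using like by (auto simp: P_like_def continuum_def)
  obtain z where z: "z \<in> X" "\<And>x. x \<in> X \<Longrightarrow> dist z (f z) \<le> dist x (f x)"
    using continuous_attains_inf[OF comp \<open>X \<noteq> {}\<close>, of "\<lambda>x. dist x (f x)"]
      continuous_on_dist[OF continuous_on_id cont] by auto
  define \<mu> where "\<mu> = dist z (f z)"
  have \<mu>: "0 < \<mu>" "\<And>x. x \<in> X \<Longrightarrow> \<mu> \<le> dist x (f x)"
    using z free[of z] by (auto simp: \<mu>_def)
  obtain \<U>1 where U1: "P_cover \<P> X \<U>1" "taut \<U>1" "{} \<notin> \<U>1" "\<forall>A\<in>\<U>1. diameter A < \<mu> / 2"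
    using P_like_refinement[OF like cont fX, of "{X}" "\<mu> / 2"] \<mu>(1) by auto
  \<comment> \<open>Otherwise \<open>x\<close> could be joined to \<open>f x\<close> through a common point of \<open>A\<close> and \<open>B\<close>.\<close>
  have disj: "A \<inter> B = {}" if "A \<in> \<U>1" "B \<in> \<U>1" "x \<in> A" "f x \<in> B" for A B x
  proof (rule ccontr)
    assume "A \<inter> B \<noteq> {}"
    then obtain y where y: "y \<in> A" "y \<in> B" by blast
    have "A \<subseteq> X" "B \<subseteq> X" using U1(1) that by (auto simp: P_cover_def)
    then have "dist x y < \<mu> / 2" "dist y (f x) < \<mu> / 2"
      using dist_le_diameter[OF comp] U1(4) that y by (meson le_less_trans)+
    then have "dist x (f x) < \<mu>" using dist_triangle[of x "f x" y] by simp
    then show False using \<mu>(2)[of x] that \<open>A \<subseteq> X\<close> by force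
  qed
  define \<rho> where "\<rho> = min_gap \<U>1"
  have "0 < \<rho>"
  proof -
    have c1: "finite \<U>1" "\<Union>\<U>1 = X" using U1(1) by (auto simp: P_cover_def)
    have "f z \<in> X" using z fX by blast
    then obtain A B where "A \<in> \<U>1" "B \<in> \<U>1" "z \<in> A" "f z \<in> B"
      using c1 z by (metis UnionE)
    then show ?thesis
      unfolding \<rho>_def using disj
      by (intro min_gap_pos[OF comp c1(1) U1(2), of A B]) (use c1 in auto)
  qed
  define good where "good = (\<lambda>\<V>. P_cover \<P> X \<V> \<and> taut \<V> \<and> {} \<notin> \<V>)"
  define step where "step = (\<lambda>n \<V> \<W>. strongly_refines \<W> \<V> \<and>
      (\<forall>A\<in>\<W>. diameter A < \<rho> / 2 ^ (n + 2)) \<and> images_absorbed f \<W> \<V>)"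
  have "\<exists>s. \<forall>n. (good (s n) \<and> (n = 0 \<longrightarrow> s n = \<U>1)) \<and> step n (s n) (s (Suc n))"
  proof (rule dependent_nat_choice)
    show "\<exists>\<V>. good \<V> \<and> (0 = (0::nat) \<longrightarrow> \<V> = \<U>1)" using U1 by (auto simp: good_def)
    fix \<V> and n :: nat assume "good \<V> \<and> (n = 0 \<longrightarrow> \<V> = \<U>1)"
    then have V: "\<And>U. U \<in> \<V> \<Longrightarrow> openin (top_of_set X) U" "\<Union>\<V> = X"
      by (auto simp: good_def P_cover_def)
    obtain \<W> where "good \<W>" "step n \<V> \<W>"
      using P_like_refinement[OF like cont fX V, of "\<rho> / 2 ^ (n + 2)"] \<open>0 < \<rho>\<close>
      by (auto simp: good_def step_def)
    then show "\<exists>\<W>. (good \<W> \<and> (Suc n = 0 \<longrightarrow> \<W> = \<U>1)) \<and> step n \<V> \<W>" by auto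
  qed
  then obtain s where s: "\<And>n. good (s n)" "s 0 = \<U>1" "\<And>n. step n (s n) (s (Suc n))"
    by blast
  \<comment> \<open>Recursion starts at 0, but the covers are numbered from 1; \<open>step n\<close> thus bounds the diameters
    in the cover numbered \<open>n + 2\<close>.\<close>
  define \<U> where "\<U> = (\<lambda>n::nat. s (n - 1))"
  have good: "good (\<U> n)" for n by (simp add: \<U>_def s)
  have \<U>_1: "\<U> 1 = \<U>1" by (simp add: \<U>_def s)
  have step: "step (n - 1) (\<U> n) (\<U> (n + 1))" if "n \<ge> 1" for n
    using s(3)[of "n - 1"] that by (simp add: \<U>_def)
  have un: "\<Union>(\<U> n) = X" for n using good[of n] by (simp add: good_def P_cover_def)
  define \<phi> where "\<phi> = (\<lambda>n A. SOME B. B \<in> \<U> n \<and>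
      (\<forall>W\<in>\<U> (n + 1). W \<inter> f ` A \<noteq> {} \<longrightarrow> W \<subseteq> B))"
  have \<phi>: "\<phi> n A \<in> \<U> n" "\<And>W. W \<in> \<U> (n + 1) \<Longrightarrow> W \<inter> f ` A \<noteq> {} \<Longrightarrow> W \<subseteq> \<phi> n A"
    if "n \<ge> 1" "A \<in> \<U> (n + 1)" for n A
  proof -
    have "\<exists>B. B \<in> \<U> n \<and> (\<forall>W\<in>\<U> (n + 1). W \<inter> f ` A \<noteq> {} \<longrightarrow> W \<subseteq> B)"
      using step[OF that(1)] that(2) unfolding step_def images_absorbed_def by blast
    from someI_ex[OF this]
    show "\<phi> n A \<in> \<U> n" "\<And>W. W \<in> \<U> (n + 1) \<Longrightarrow> W \<inter> f ` A \<noteq> {} \<Longrightarrow> W \<subseteq> \<phi> n A"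
      unfolding \<phi>_def by blast+
  qed
  have f\<phi>: "f x \<in> \<phi> n A" if n: "n \<ge> 1" and A: "A \<in> \<U> (n + 1)" and x: "x \<in> A" for n A x
  proof -
    have "x \<in> X" using un A x by blast
    then have "f x \<in> X" using fX by blast
    then obtain W where "W \<in> \<U> (n + 1)" "f x \<in> W" using un by blast
    then show ?thesis using \<phi>(2)[OF n A] x by blast
  qed
  show ?thesis
  proof (rule that)
    show "pattern_maps \<U> \<phi>" unfolding pattern_maps_def using \<phi>(1) by auto
    show "D1 \<U> \<phi>"
      unfolding D1_def
    proof (intro ballI impI)
      fix U V assume *: "U \<in> \<U> 1" "V \<in> \<U> 2" "U \<inter> V \<noteq> {}"
      then obtain x where x: "x \<in> U" "x \<in> V" by blast
      have V: "V \<in> \<U> (1 + 1)" using * by (simp add: numeral_2_eq_2)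
      have "U \<inter> \<phi> 1 V = {}"
        using disj[of U "\<phi> 1 V" x] *(1) \<phi>(1)[OF _ V] f\<phi>[OF _ V x(2)] x \<U>_1 by simp
      then show "\<phi> 1 V \<inter> U = {}" by blast
    qed
    show "D2 \<U> \<phi>"
      unfolding D2_def
    proof (intro allI ballI impI)
      fix n :: nat and U V
      assume *: "n \<ge> 1" "U \<in> \<U> (n + 2)" "V \<in> \<U> (n + 1)" "U \<inter> V \<noteq> {}"
      then obtain x where "x \<in> U" "x \<in> V" by blast
      then have "f x \<in> \<phi> (n + 1) U" "f x \<in> \<phi> n V"
        using f\<phi>[of "n + 1" U x] f\<phi>[of n V x] * by auto
      then show "\<phi> (n + 1) U \<inter> \<phi> n V \<noteq> {}" by blast
    qed
    show "D3 \<U> \<phi>"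
      unfolding D3_def using f\<phi> by blast
    show "D2' \<U> \<phi>"
      unfolding D2'_def
    proof (intro allI ballI impI)
      fix n :: nat and U V
      assume *: "n \<ge> 1" "U \<in> \<U> (n + 2)" "V \<in> \<U> (n + 1)" "closure U \<subseteq> V"
      then have U: "U \<in> \<U> ((n + 1) + 1)" by simp
      \<comment> \<open>An empty \<open>U\<close> would have its closure in every \<open>V\<close>; a point of \<open>U\<close> is needed to tie
        \<open>\<phi> (n + 1) U\<close> to \<open>f ` V\<close>.\<close>
      have "U \<noteq> {}" using good[of "n + 2"] * unfolding good_def by blast
      then obtain x where x: "x \<in> U" "x \<in> V" using * closure_subset by blast
      have "\<phi> (n + 1) U \<in> \<U> (n + 1)" "f x \<in> \<phi> (n + 1) U"
        using \<phi>(1)[OF _ U] f\<phi>[OF _ U x(1)] * by auto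
      then show "\<phi> (n + 1) U \<subseteq> \<phi> n V" using \<phi>(2)[OF *(1,3)] x by blast
    qed
    show "diameter A < min_gap (\<U> 1) / 2 ^ n" if n: "n \<ge> 2" and A: "A \<in> \<U> n" for n A
    proof -
      have "n - 1 - 1 + 2 = n" "n - 1 + 1 = n" using n by auto
      then show ?thesis
        using step[of "n - 1"] n A unfolding step_def \<U>_1 \<rho>_def[symmetric] by auto
    qed
  qed (use good step in \<open>auto simp: good_def step_def\<close>)
qed

section \<open>The map carried by a pattern\<close>

lemma P_like_of_small_covers:
  fixes X :: "'a::metric_space set"
  assumes "continuum X" and cov: "\<And>n. n \<ge> 1 \<Longrightarrow> P_cover \<P> X (\<U> n)"
    and diam: "\<And>n A. n \<ge> 2 \<Longrightarrow> A \<in> \<U> n \<Longrightarrow> diameter A \<le> m n" and m: "m \<longlonglongrightarrow> 0"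
  shows "P_like \<P> X"
  unfolding P_like_def
proof (intro conjI allI impI)
  have X: "compact X" "X \<noteq> {}" using assms(1) by (auto simp: continuum_def)
  fix \<C> assume \<C>: "(\<forall>C\<in>\<C>. openin (top_of_set X) C) \<and> \<Union>\<C> = X"
  then obtain \<epsilon> where \<epsilon>: "0 < \<epsilon>" "\<And>x. x \<in> X \<Longrightarrow> \<exists>C\<in>\<C>. X \<inter> ball x \<epsilon> \<subseteq> C"
    using relative_Lebesgue_number[OF X(1), of \<C>] by blast
  have "\<forall>\<^sub>F n in sequentially. m n < \<epsilon> \<and> n \<ge> 2"
    using order_tendstoD(2)[OF m \<epsilon>(1)] eventually_ge_at_top by (rule eventually_conj)
  then obtain n where n: "m n < \<epsilon>" "n \<ge> 2"
    using eventually_happens'[OF sequentially_bot] by blast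
  have "\<exists>C\<in>\<C>. U \<subseteq> C" if U: "U \<in> \<U> n" for U
  proof (cases "U = {}")
    case True
    then show ?thesis using \<C> X by blast
  next
    case False
    then obtain x where x: "x \<in> U" by blast
    have UX: "U \<subseteq> X" using cov[of n] n U by (auto simp: P_cover_def)
    have "U \<subseteq> X \<inter> ball x \<epsilon>"
      using dist_le_diameter[OF X(1) UX x] diam[OF n(2) U] n(1) UX by force
    then show ?thesis using \<epsilon>(2)[of x] x UX by blast
  qed
  then show "\<exists>\<U>. P_cover \<P> X \<U> \<and> (\<forall>U\<in>\<U>. \<exists>C\<in>\<C>. U \<subseteq> C)"
    using cov[of n] n by auto
qed (rule assms)

lemma D3_meet:
  assumes "D3 \<U> \<phi>" "n \<ge> 1" "V \<in> \<U> (n + 1)" "W \<in> \<U> (n + 1)" "x \<in> V" "x \<in> W"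
  obtains q where "q \<in> \<phi> n V" "q \<in> \<phi> n W"
proof -
  have "V \<inter> W \<noteq> {}" using assms by blast
  then have "\<phi> n V \<inter> \<phi> n W \<noteq> {}" using assms unfolding D3_def by simp
  then show thesis using that by blast
qed

text \<open>
  Condition \<open>descend\<close> is the common content of (D2) and (D2'): a point of the approximation of \<open>f x\<close>
  at level \<open>n + 1\<close> has a point of the approximation at level \<open>n\<close> within \<open>c / 2 ^ (n + 1)\<close>. Here
  \<open>c\<close> is the gap of the first cover under (D2), and \<open>0\<close> under (D2'). Descending from level
  \<open>N\<close> to level \<open>n\<close> costs at most \<open>c / 2 ^ n\<close>, by the geometric series; with (D3) and vanishing
  mesh this makes any selection of approximations a Cauchy sequence. The diameter bound starts at
  level 2 because under (D2) nothing is known about the mesh of the first cover; at level 1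
  only the cost \<open>c / 2\<close> of the descent enters the conclusion.
\<close>

proposition limit_map:
  fixes X :: "'a::metric_space set" and \<U> :: "nat \<Rightarrow> 'a set set"
  assumes comp: "compact X" and cov: "\<And>n. n \<ge> 1 \<Longrightarrow> P_cover \<P> X (\<U> n)"
    and maps: "pattern_maps \<U> \<phi>" and D3: "D3 \<U> \<phi>"
    and diam: "\<And>n A. n \<ge> 2 \<Longrightarrow> A \<in> \<U> n \<Longrightarrow> diameter A \<le> m n" and m: "m \<longlonglongrightarrow> 0"
    and "0 \<le> c"
    and descend: "\<And>n x V a. n \<ge> 1 \<Longrightarrow> V \<in> \<U> (n + 2) \<Longrightarrow> x \<in> V \<Longrightarrow> a \<in> \<phi> (n + 1) V \<Longrightarrow>
      \<exists>W\<in>\<U> (n + 1). x \<in> W \<and> (\<exists>b\<in>\<phi> n W. dist a b \<le> c / 2 ^ (n + 1))"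
  shows "\<exists>f. continuous_on X f \<and> f ` X \<subseteq> X \<and>
    (\<forall>x\<in>X. \<forall>e>0. \<exists>V\<in>\<U> 2. x \<in> V \<and> (\<exists>b\<in>\<phi> 1 V. dist (f x) b < c / 2 + e))"
proof -
  have un: "\<Union>(\<U> n) = X" and opn: "\<And>U. U \<in> \<U> n \<Longrightarrow> openin (top_of_set X) U"
    if "n \<ge> 1" for n using cov[OF that] by (auto simp: P_cover_def)
  define C where "C = (\<lambda>n x. \<Union>{\<phi> n V | V. V \<in> \<U> (n + 1) \<and> x \<in> V})"
  have \<phi>_in: "\<phi> n V \<in> \<U> n" if "n \<ge> 1" "V \<in> \<U> (n + 1)" for n V
    using maps that unfolding pattern_maps_def by auto
  have C_sub: "C n x \<subseteq> X" if "n \<ge> 1" for n x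
    unfolding C_def using \<phi>_in un that by blast
  have C_ne: "C n x \<noteq> {}" if n: "n \<ge> 1" and x: "x \<in> X" for n x
  proof -
    have "\<Union>(\<U> (n + 1)) = X" using un by simp
    then obtain V where "V \<in> \<U> (n + 1)" "x \<in> V" using x by blast
    moreover from this obtain q where "q \<in> \<phi> n V" using D3_meet[OF D3 n] by metis
    ultimately show ?thesis unfolding C_def by blast
  qed
  \<comment> \<open>By (D3) any two approximations from members sharing \<open>x\<close> meet.\<close>
  have near: "dist a b \<le> 2 * m n"
    if n: "n \<ge> 2" and V: "V \<in> \<U> (n + 1)" "x \<in> V" and a: "a \<in> C n x" and b: "b \<in> \<phi> n V"
    for n x V a b
  proof -
    obtain W where W: "W \<in> \<U> (n + 1)" "x \<in> W" "a \<in> \<phi> n W" using a unfolding C_def by blast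
    have n1: "n \<ge> 1" using n by simp
    obtain q where q: "q \<in> \<phi> n W" "q \<in> \<phi> n V"
      by (rule D3_meet[OF D3 n1 W(1) V(1) W(2) V(2)])
    have small: "dist p q \<le> m n" if "U \<in> \<U> (n + 1)" "p \<in> \<phi> n U" "q \<in> \<phi> n U" for p q U
    proof -
      have "\<phi> n U \<in> \<U> n" by (rule \<phi>_in[OF n1 that(1)])
      moreover then have "\<phi> n U \<subseteq> X" using un[OF n1] by blast
      ultimately show ?thesis
        using dist_le_diameter[OF comp _ that(2,3)] diam[OF n] order_trans by blast
    qed
    show ?thesis
      using small[OF W(1,3) q(1)] small[OF V(1) q(2) b] dist_triangle[of a b q] by simp
  qed
  \<comment> \<open>Here \<open>\<phi> n V\<close> serves as a bridge between \<open>C n x\<close> and \<open>C n y\<close>. The case \<open>y = x\<close> bounds the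
    diameter of \<open>C n x\<close>, and the general case gives continuity.\<close>
  have near2: "dist a b \<le> 4 * m n"
    if n: "n \<ge> 2" and V: "V \<in> \<U> (n + 1)" "x \<in> V" "y \<in> V" and ab: "a \<in> C n x" "b \<in> C n y"
    for n x y V a b
  proof -
    have "n \<ge> 1" using n by simp
    then obtain q where q: "q \<in> \<phi> n V" using D3_meet[OF D3 _ V(1,1,2,2)] by metis
    have "dist a q \<le> 2 * m n" "dist b q \<le> 2 * m n"
      using near[OF n V(1,2) ab(1) q] near[OF n V(1,3) ab(2) q] .
    then show ?thesis using dist_triangle2[of a b q] by simp
  qed
  have chain: "\<exists>b\<in>C n x. dist a b \<le> c / 2 ^ n - c / 2 ^ (n + k)"
    if n: "n \<ge> 1" and a: "a \<in> C (n + k) x" for n k x a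
    using a
  proof (induction k arbitrary: a)
    case 0
    then show ?case by auto
  next
    case (Suc k)
    then obtain V where "V \<in> \<U> (n + k + 2)" "x \<in> V" "a \<in> \<phi> (n + k + 1) V"
      unfolding C_def by auto
    then obtain W a' where "W \<in> \<U> (n + k + 1)" "x \<in> W" "a' \<in> \<phi> (n + k) W"
        and aa': "dist a a' \<le> c / 2 ^ (n + k + 1)"
      using descend[of "n + k" V x a] n by auto
    then have "a' \<in> C (n + k) x" unfolding C_def by blast
    then obtain b where b: "b \<in> C n x" "dist a' b \<le> c / 2 ^ n - c / 2 ^ (n + k)"
      using Suc.IH by blast
    have "dist a b \<le> c / 2 ^ (n + k + 1) + (c / 2 ^ n - c / 2 ^ (n + k))"
      using dist_triangle[of a b a'] aa' b by simp
    also have "\<dots> = c / 2 ^ n - c / 2 ^ (n + Suc k)"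
      by (simp add: field_simps)
    finally show ?case using b(1) by blast
  qed
  have chain': "\<exists>b\<in>C n x. dist a b \<le> c / 2 ^ n" if n: "n \<ge> 1" "N \<ge> n" and a: "a \<in> C N x" for n N x a
  proof -
    have "a \<in> C (n + (N - n)) x" using n a by simp
    then obtain b where "b \<in> C n x" "dist a b \<le> c / 2 ^ n - c / 2 ^ (n + (N - n))"
      using chain[OF n(1)] by blast
    moreover have "0 \<le> c / 2 ^ (n + (N - n))" using \<open>0 \<le> c\<close> by simp
    ultimately show ?thesis by (intro bexI[of _ b]) auto
  qed
  \<comment> \<open>The cost of descending to level \<open>n\<close> plus the diameter there.\<close>
  define r where "r = (\<lambda>n. c / 2 ^ n + 4 * m n)"
  have "(\<lambda>n. c / 2 ^ n) \<longlonglongrightarrow> 0"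
    using tendsto_mult[OF tendsto_const[of c] LIMSEQ_inverse_realpow_zero[of 2]]
    by (simp add: divide_inverse)
  then have r: "r \<longlonglongrightarrow> 0"
    unfolding r_def using tendsto_add[OF _ tendsto_mult[OF tendsto_const[of 4] m]] by fastforce
  define s where "s = (\<lambda>x n. SOME a. a \<in> C n x)"
  have s_in: "s x n \<in> C n x" if "n \<ge> 1" "x \<in> X" for x n
    unfolding s_def using C_ne[OF that] by (simp add: some_in_eq)
  have s_close: "dist (s x N) (s x n) \<le> r n" if n: "n \<ge> 2" "N \<ge> n" and x: "x \<in> X" for x n N
  proof -
    have n1: "n \<ge> 1" "N \<ge> 1" using n by auto
    obtain b where b: "b \<in> C n x" "dist (s x N) b \<le> c / 2 ^ n"
      using chain'[OF n1(1) n(2) s_in[OF n1(2) x]] by blast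
    have "\<Union>(\<U> (n + 1)) = X" using un by simp
    then obtain V where "V \<in> \<U> (n + 1)" "x \<in> V" using x by blast
    then have "dist b (s x n) \<le> 4 * m n" using near2[OF n(1) _ _ _ b(1) s_in[OF n1(1) x]] by blast
    then show ?thesis using b(2) dist_triangle[of "s x N" "s x n" b] by (simp add: r_def)
  qed
  have "\<exists>l\<in>X. s x \<longlonglongrightarrow> l" if x: "x \<in> X" for x
  proof -
    have "Cauchy (s x)"
    proof (rule metric_CauchyI)
      fix e :: real assume "0 < e"
      then have "\<forall>\<^sub>F n in sequentially. r n < e / 2 \<and> n \<ge> 2"
        by (intro eventually_conj order_tendstoD(2)[OF r] eventually_ge_at_top) simp
      then obtain n where n: "r n < e / 2" "n \<ge> 2"
        using eventually_happens'[OF sequentially_bot] by blast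
      have "dist (s x i) (s x j) < e" if "i \<ge> n" "j \<ge> n" for i j
        using s_close[OF n(2) that(1) x] s_close[OF n(2) that(2) x] n(1)
          dist_triangle2[of "s x i" "s x j" "s x n"] by simp
      then show "\<exists>M. \<forall>i\<ge>M. \<forall>j\<ge>M. dist (s x i) (s x j) < e" by blast
    qed
    then have "Cauchy (\<lambda>n. s x (n + 1))" using Cauchy_subseq_Cauchy[of "s x" "\<lambda>n. n + 1"]
      by (simp add: strict_mono_def comp_def)
    moreover have "\<forall>n. s x (n + 1) \<in> X" using s_in[OF _ x] C_sub by force
    ultimately obtain l where "l \<in> X" "(\<lambda>n. s x (n + 1)) \<longlonglongrightarrow> l"
      using completeE[OF compact_imp_complete[OF comp], of "\<lambda>n. s x (n + 1)"] by metis
    then show ?thesis using LIMSEQ_offset[of "s x" 1 l] by auto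
  qed
  then have "\<forall>x\<in>X. \<exists>l. l \<in> X \<and> s x \<longlonglongrightarrow> l" by blast
  from bchoice[OF this] obtain f where f: "\<And>x. x \<in> X \<Longrightarrow> f x \<in> X"
    "\<And>x. x \<in> X \<Longrightarrow> s x \<longlonglongrightarrow> f x" by blast
  have f_close: "dist (f x) (s x n) \<le> r n" if "n \<ge> 2" "x \<in> X" for x n
  proof (rule tendsto_upperbound)
    show "(\<lambda>N. dist (s x N) (s x n)) \<longlonglongrightarrow> dist (f x) (s x n)"
      using f(2)[OF that(2)] by (intro tendsto_dist tendsto_const)
    show "\<forall>\<^sub>F N in sequentially. dist (s x N) (s x n) \<le> r n"
      using s_close that by (auto simp: eventually_sequentially)
  qed simp
  have "continuous_on X f"
    unfolding continuous_on_eq_continuous_within continuous_within_eps_delta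
  proof (intro ballI allI impI)
    fix x and e :: real assume x: "x \<in> X" and "0 < e"
    have m4: "(\<lambda>n. 4 * m n) \<longlonglongrightarrow> 0" using tendsto_mult[OF tendsto_const[of 4] m] by simp
    have "\<forall>\<^sub>F n in sequentially. (r n < e / 3 \<and> 4 * m n < e / 3) \<and> n \<ge> 2"
      using \<open>0 < e\<close>
      by (intro eventually_conj order_tendstoD(2)[OF r] order_tendstoD(2)[OF m4]
          eventually_ge_at_top) auto
    then obtain n where n: "r n < e / 3" "4 * m n < e / 3" "n \<ge> 2"
      using eventually_happens'[OF sequentially_bot] by blast
    have "\<Union>(\<U> (n + 1)) = X" using un by simp
    then obtain V where V: "V \<in> \<U> (n + 1)" "x \<in> V" using x by blast
    then have "openin (top_of_set X) V" using opn[of "n + 1"] by simp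
    then obtain d where d: "d > 0" "\<And>y. y \<in> X \<Longrightarrow> dist y x < d \<Longrightarrow> y \<in> V"
      using V(2) unfolding openin_euclidean_subtopology_iff by blast
    have "dist (f y) (f x) < e" if y: "y \<in> X" "dist y x < d" for y
    proof -
      have "y \<in> V" using d y by blast
      have n1: "n \<ge> 1" using n by simp
      have "dist (s y n) (s x n) \<le> 4 * m n"
        using near2[OF n(3) V(1) \<open>y \<in> V\<close> V(2) s_in[OF n1 y(1)] s_in[OF n1 x]] .
      then show ?thesis
        using f_close[OF n(3) y(1)] f_close[OF n(3) x] n
          dist_triangle[of "f y" "f x" "s y n"] dist_triangle2[of "s y n" "f x" "s x n"] by linarith
    qed
    then show "\<exists>d>0. \<forall>y\<in>X. dist y x < d \<longrightarrow> dist (f y) (f x) < e" using d(1) by blast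
  qed
  moreover have "\<exists>V\<in>\<U> 2. x \<in> V \<and> (\<exists>b\<in>\<phi> 1 V. dist (f x) b < c / 2 + e)"
    if x: "x \<in> X" and "0 < e" for x e
  proof -
    have "\<forall>\<^sub>F n in sequentially. dist (s x n) (f x) < e \<and> n \<ge> 1"
      by (intro eventually_conj tendstoD[OF f(2)[OF x] \<open>0 < e\<close>] eventually_ge_at_top)
    then obtain n where n: "dist (s x n) (f x) < e" "n \<ge> 1"
      using eventually_happens'[OF sequentially_bot] by blast
    obtain b where b: "b \<in> C 1 x" "dist (s x n) b \<le> c / 2"
      using chain'[OF _ n(2) s_in[OF n(2) x]] by auto
    have "dist (f x) b < c / 2 + e"
      using n(1) b(2) dist_triangle3[of "f x" b "s x n"] by simp
    then show ?thesis using b(1) unfolding C_def by (auto simp: numeral_2_eq_2)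
  qed
  ultimately show ?thesis using f(1) by (intro exI[of _ f]) auto
qed

text \<open>
  A fixed point \<open>x\<close> of the limit map would lie in a member \<open>U\<close> of the first cover and yet at
  distance less than \<open>\<rho>\<close> from some \<open>\<phi> 1 V\<close> with \<open>x \<in> V\<close>, whereas (D1) makes \<open>\<phi> 1 V\<close> disjoint from
  \<open>U\<close>, hence at distance at least \<open>\<rho>\<close>.
\<close>

lemma fpf_pattern_imp_no_fixed_point_property:
  fixes X :: "'a::metric_space set" and \<U> :: "nat \<Rightarrow> 'a set set"
  assumes "continuum X" and cov: "\<And>n. n \<ge> 1 \<Longrightarrow> P_cover \<P> X (\<U> n)"
    and diam: "\<And>n A. n \<ge> 2 \<Longrightarrow> A \<in> \<U> n \<Longrightarrow> diameter A < min_gap (\<U> 1) / 2 ^ n"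
    and pat: "follows_fpf_pattern \<U>"
  shows "P_like \<P> X \<and> \<not> fixed_point_property X"
proof -
  have X: "compact X" "X \<noteq> {}" using assms(1) by (auto simp: continuum_def)
  obtain \<phi> where \<phi>: "pattern_maps \<U> \<phi>" "D1 \<U> \<phi>" "D2 \<U> \<phi>" "D3 \<U> \<phi>"
    using pat unfolding follows_fpf_pattern_def by blast
  define \<rho> where "\<rho> = min_gap (\<U> 1)"
  have un: "\<Union>(\<U> n) = X" if "n \<ge> 1" for n using cov[OF that] by (auto simp: P_cover_def)
  \<comment> \<open>The second cover has a member, whose diameter is nonnegative and below \<open>\<rho> / 4\<close>.\<close>
  have "0 < \<rho>"
  proof -
    obtain A where A: "A \<in> \<U> 2" using un[of 2] X by auto
    then have "A \<subseteq> X" using un[of 2] by auto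
    then have "0 \<le> diameter A"
      using X bounded_subset compact_imp_bounded diameter_ge_0 by blast
    then have "0 < \<rho> / 2 ^ 2" using diam[OF _ A] by (simp add: \<rho>_def)
    then show ?thesis by simp
  qed
  have le: "diameter A \<le> \<rho> / 2 ^ n" if "n \<ge> 2" "A \<in> \<U> n" for n A
    using diam[OF that] by (simp add: \<rho>_def)
  have lim: "(\<lambda>n. \<rho> / 2 ^ n) \<longlonglongrightarrow> 0"
    using tendsto_mult[OF tendsto_const[of \<rho>] LIMSEQ_inverse_realpow_zero[of 2]]
    by (simp add: divide_inverse)
  have descend: "\<exists>W\<in>\<U> (n + 1). x \<in> W \<and> (\<exists>b\<in>\<phi> n W. dist a b \<le> \<rho> / 2 ^ (n + 1))"
    if n: "n \<ge> 1" and V: "V \<in> \<U> (n + 2)" "x \<in> V" and a: "a \<in> \<phi> (n + 1) V" for n x V a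
  proof -
    have "x \<in> X" using un[of "n + 2"] V by auto
    then obtain W where W: "W \<in> \<U> (n + 1)" "x \<in> W" using un[of "n + 1"] by auto
    then obtain b where b: "b \<in> \<phi> (n + 1) V" "b \<in> \<phi> n W"
      using \<phi>(3) n V unfolding D2_def by blast
    have "\<phi> (n + 1) V \<in> \<U> (n + 1)" using \<phi>(1) V unfolding pattern_maps_def by auto
    then have "dist a b \<le> \<rho> / 2 ^ (n + 1)"
      using dist_le_diameter[OF X(1) _ a b(1)] le[of "n + 1"] un[of "n + 1"] n by fastforce
    then show ?thesis using W b by blast
  qed
  have "\<exists>f. continuous_on X f \<and> f ` X \<subseteq> X \<and>
      (\<forall>x\<in>X. \<forall>e>0. \<exists>V\<in>\<U> 2. x \<in> V \<and> (\<exists>b\<in>\<phi> 1 V. dist (f x) b < \<rho> / 2 + e))"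
    by (rule limit_map[OF X(1) cov \<phi>(1,4) le lim less_imp_le[OF \<open>0 < \<rho>\<close>] descend])
  then obtain f where f: "continuous_on X f" "f ` X \<subseteq> X"
    "\<forall>x\<in>X. \<forall>e>0. \<exists>V\<in>\<U> 2. x \<in> V \<and> (\<exists>b\<in>\<phi> 1 V. dist (f x) b < \<rho> / 2 + e)"
    by blast
  have "f x \<noteq> x" if x: "x \<in> X" for x
  proof
    assume "f x = x"
    obtain V b where V: "V \<in> \<U> 2" "x \<in> V" "b \<in> \<phi> 1 V" "dist (f x) b < \<rho> / 2 + \<rho> / 2"
      using f(3)[rule_format, OF x, of "\<rho> / 2"] \<open>0 < \<rho>\<close> by auto
    obtain U where U: "U \<in> \<U> 1" "x \<in> U" using un[of 1] x by auto
    have "\<phi> 1 V \<inter> U = {}" using \<phi>(2) U V unfolding D1_def by blast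
    moreover have "\<phi> 1 V \<in> \<U> 1"
      using \<phi>(1) V unfolding pattern_maps_def by (auto simp: numeral_2_eq_2)
    moreover have "finite (\<U> 1)" using cov[of 1] by (simp add: P_cover_def)
    ultimately have "\<rho> \<le> setdist U (\<phi> 1 V)"
      unfolding \<rho>_def by (intro min_gap_le) (use U V in auto)
    also have "\<dots> \<le> dist x b" by (rule setdist_le_dist[OF U(2) V(3)])
    finally show False using V(4) \<open>f x = x\<close> by simp
  qed
  then have "\<not> fixed_point_property X"
    unfolding fixed_point_property_def using f(1,2) by blast
  moreover have "P_like \<P> X"
    by (rule P_like_of_small_covers[OF assms(1) cov le lim])
  ultimately show ?thesis by blast
qed

text \<open>
  Under (D2') the approximations of \<open>f x\<close> decrease, because strong refinement supplies to each \<open>V\<close>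
  containing \<open>x\<close> a coarser member containing its closure. So \<open>f x\<close> is a limit of points of sets
  \<open>\<phi> 1 V\<close> with \<open>x \<in> V\<close>. By (D1) these sets avoid every member of the first cover containing \<open>x\<close>,
  and such a member is a neighbourhood of \<open>x\<close> in \<open>X\<close>.
\<close>

lemma D2'_fpf_pattern_imp_no_fixed_point_property:
  fixes X :: "'a::metric_space set" and \<U> :: "nat \<Rightarrow> 'a set set"
  assumes "continuum X" and cov: "\<And>n. n \<ge> 1 \<Longrightarrow> P_cover \<P> X (\<U> n)"
    and refn: "\<And>n. n \<ge> 1 \<Longrightarrow> strongly_refines (\<U> (n + 1)) (\<U> n)"
    and mesh: "(\<lambda>n. mesh (\<U> n)) \<longlonglongrightarrow> 0"
    and pat: "follows_D2'_fpf_pattern \<U>"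
  shows "P_like \<P> X \<and> \<not> fixed_point_property X"
proof -
  have X: "compact X" "X \<noteq> {}" using assms(1) by (auto simp: continuum_def)
  obtain \<phi> where \<phi>: "pattern_maps \<U> \<phi>" "D1 \<U> \<phi>" "D2' \<U> \<phi>" "D3 \<U> \<phi>"
    using pat unfolding follows_D2'_fpf_pattern_def by blast
  have un: "\<Union>(\<U> n) = X" if "n \<ge> 1" for n using cov[OF that] by (auto simp: P_cover_def)
  have le: "diameter A \<le> mesh (\<U> n)" if "n \<ge> 2" "A \<in> \<U> n" for n A
    unfolding mesh_def using cov[of n] that by (intro cSUP_upper) (auto simp: P_cover_def)
  have descend: "\<exists>W\<in>\<U> (n + 1). x \<in> W \<and> (\<exists>b\<in>\<phi> n W. dist a b \<le> 0 / 2 ^ (n + 1))"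
    if n: "n \<ge> 1" and V: "V \<in> \<U> (n + 2)" "x \<in> V" and a: "a \<in> \<phi> (n + 1) V" for n x V a
  proof -
    obtain W where W: "W \<in> \<U> (n + 1)" "closure V \<subseteq> W"
      using refn[of "n + 1"] V(1) unfolding strongly_refines_def by auto
    then have "\<phi> (n + 1) V \<subseteq> \<phi> n W" using \<phi>(3) n V(1) unfolding D2'_def by blast
    then show ?thesis using W V(2) a closure_subset by (intro bexI[of _ W]) auto
  qed
  have "\<exists>f. continuous_on X f \<and> f ` X \<subseteq> X \<and>
      (\<forall>x\<in>X. \<forall>e>0. \<exists>V\<in>\<U> 2. x \<in> V \<and> (\<exists>b\<in>\<phi> 1 V. dist (f x) b < 0 / 2 + e))"
    by (rule limit_map[OF X(1) cov \<phi>(1,4) le mesh order_refl descend])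
  then obtain f where f: "continuous_on X f" "f ` X \<subseteq> X"
    "\<forall>x\<in>X. \<forall>e>0. \<exists>V\<in>\<U> 2. x \<in> V \<and> (\<exists>b\<in>\<phi> 1 V. dist (f x) b < 0 / 2 + e)"
    by blast
  have "f x \<noteq> x" if x: "x \<in> X" for x
  proof
    assume fx: "f x = x"
    obtain U where U: "U \<in> \<U> 1" "x \<in> U" using un[of 1] x by auto
    have "openin (top_of_set X) U" using cov[of 1] U by (simp add: P_cover_def)
    then obtain d where d: "d > 0" "\<And>y. y \<in> X \<Longrightarrow> dist y x < d \<Longrightarrow> y \<in> U"
      using U(2) unfolding openin_euclidean_subtopology_iff by blast
    obtain V b where V: "V \<in> \<U> 2" "x \<in> V" "b \<in> \<phi> 1 V" "dist (f x) b < d"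
      using f(3)[rule_format, OF x d(1)] by auto
    have "\<phi> 1 V \<in> \<U> 1"
      using \<phi>(1) V unfolding pattern_maps_def by (auto simp: numeral_2_eq_2)
    then have "b \<in> U" using d(2)[of b] V(3,4) un[of 1] fx by (auto simp: dist_commute)
    moreover have "\<phi> 1 V \<inter> U = {}" using \<phi>(2) U V unfolding D1_def by blast
    ultimately show False using V by blast
  qed
  then have "\<not> fixed_point_property X"
    unfolding fixed_point_property_def using f(1,2) by blast
  moreover have "P_like \<P> X"
    by (rule P_like_of_small_covers[OF assms(1) cov le mesh])
  ultimately show ?thesis by blast
qed

section \<open>The characterization\<close>

theorem theorem3p2:
  fixes X :: "'a::metric_space set"
    and \<P> :: "'p::topological_space set set"
  assumes "continuum X"
    and "\<forall>Q\<in>\<P>. triangulable_polyhedron Q"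
  defines "T1 \<equiv> P_like \<P> X \<and> \<not> fixed_point_property X"
    and "T2 \<equiv> (\<exists>\<U> :: nat \<Rightarrow> 'a set set.
           (\<forall>n\<ge>1. P_cover \<P> X (\<U> n) \<and> taut (\<U> n)) \<and>
           (\<forall>n\<ge>1. strongly_refines (\<U> (n + 1)) (\<U> n)) \<and>
           (\<forall>n\<ge>2. eps_P_cover (min_gap (\<U> 1) / 2 ^ n) \<P> X (\<U> n)) \<and>
           follows_fpf_pattern \<U>)"
    and "T3 \<equiv> (\<exists>\<U> :: nat \<Rightarrow> 'a set set.
           (\<forall>n\<ge>1. P_cover \<P> X (\<U> n) \<and> taut (\<U> n)) \<and>
           (\<forall>n\<ge>1. strongly_refines (\<U> (n + 1)) (\<U> n)) \<and>
           (\<lambda>n. mesh (\<U> n)) \<longlonglongrightarrow> 0 \<and>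
           follows_D2'_fpf_pattern \<U>)"
  shows "(T1 \<longleftrightarrow> T2) \<and> (T2 \<longleftrightarrow> T3)"
proof -
  have X: "compact X" "X \<noteq> {}" using assms(1) by (auto simp: continuum_def)
  have "T2 \<and> T3" if T1
  proof -
    have *: "P_like \<P> X" "\<not> fixed_point_property X" using that unfolding T1_def by auto
    from covers_following_fixed_point_free_map[OF *]
    obtain \<U> :: "nat \<Rightarrow> 'a set set" and \<phi> where
      U: "\<And>n. n \<ge> 1 \<Longrightarrow> P_cover \<P> X (\<U> n)" "\<And>n. n \<ge> 1 \<Longrightarrow> taut (\<U> n)"
        "\<And>n. n \<ge> 1 \<Longrightarrow> strongly_refines (\<U> (n + 1)) (\<U> n)"
      and small: "\<And>n A. n \<ge> 2 \<Longrightarrow> A \<in> \<U> n \<Longrightarrow> diameter A < min_gap (\<U> 1) / 2 ^ n"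
      and \<phi>: "pattern_maps \<U> \<phi>" "D1 \<U> \<phi>" "D2 \<U> \<phi>" "D2' \<U> \<phi>" "D3 \<U> \<phi>"
      by blast
    have "follows_fpf_pattern \<U>" "follows_D2'_fpf_pattern \<U>"
      using \<phi> unfolding follows_fpf_pattern_def follows_D2'_fpf_pattern_def by blast+
    moreover have "(\<lambda>n. mesh (\<U> n)) \<longlonglongrightarrow> 0"
      by (rule mesh_tendsto_0[OF X U(1) less_imp_le[OF small]])
    moreover have "eps_P_cover (min_gap (\<U> 1) / 2 ^ n) \<P> X (\<U> n)" if "n \<ge> 2" for n
      unfolding eps_P_cover_def using small U(1)[of n] that by auto
    ultimately show ?thesis
      unfolding T2_def T3_def using U by blast
  qed
  moreover have T1 if h: T2
  proof -
    obtain \<U> :: "nat \<Rightarrow> 'a set set" where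
      U: "\<forall>n\<ge>1. P_cover \<P> X (\<U> n) \<and> taut (\<U> n)"
        "\<forall>n\<ge>2. eps_P_cover (min_gap (\<U> 1) / 2 ^ n) \<P> X (\<U> n)" "follows_fpf_pattern \<U>"
      using h unfolding T2_def by blast
    show ?thesis
      unfolding T1_def
      by (rule fpf_pattern_imp_no_fixed_point_property[OF assms(1) _ _ U(3)])
        (use U in \<open>auto simp: eps_P_cover_def\<close>)
  qed
  moreover have T1 if h: T3
  proof -
    obtain \<U> :: "nat \<Rightarrow> 'a set set" where
      U: "\<forall>n\<ge>1. P_cover \<P> X (\<U> n) \<and> taut (\<U> n)"
        "\<forall>n\<ge>1. strongly_refines (\<U> (n + 1)) (\<U> n)"
        "(\<lambda>n. mesh (\<U> n)) \<longlonglongrightarrow> 0" "follows_D2'_fpf_pattern \<U>"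
      using h unfolding T3_def by blast
    show ?thesis
      unfolding T1_def
      by (rule D2'_fpf_pattern_imp_no_fixed_point_property[OF assms(1) _ _ U(3,4)])
        (use U in auto)
  qed
  ultimately show ?thesis by blast
qed

end
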